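(* Let $k$ be a field, let $G$ be a connected finite graph with loops (that is, loops are allowed and $G$ has at least one loop; there are no multiple edges) with vertex set $V(G)=\{x_1,\dots,x_n\}$, let $R=k[x_1,\dots,x_n]$, and let $I=I(G)\subseteq R$ be the edge ideal of $G$. Let $\ell$ be an integer. If there exists $u\in V(G)$ with $d(u,x)\geq \ell$ for all vertices $x$ such that $\{x,x\}\in E(G)$, then $$\operatorname{depth} R/I\ \geq\ \left\lceil \frac{\ell-1}{3}\right\rceil .$$
   Context: Vertices of $G$ are identified with the variables of $R$. The edge ideal $I(G)$ is the ideal of $R$ generated by the monomials $xy$ with $\{x,y\}\in E(G)$; a loop $\{x,x\}\in E(G)$ contributes the generator $x^2$. The distance $d(u,x)$ is the length of a shortest path between $u$ and $x$ (loops do not affect distances). $\operatorname{depth} R/I$ is the maximum length of an $R/I$-regular sequence in $\mathfrak m=(x_1,\dots,x_n)$. *)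

theory Defs
  imports
    "HOL-Library.Poly_Mapping"
    "HOL-Library.Extended_Nat"
    "HOL-Algebra.Algebra"
    "HOL-Algebra.Algebraic_Closure_Type"
begin

section \<open>Depth of a module\<close>

text \<open>
  The submodule \<open>A M\<close> of \<open>M\<close> generated by all products \<open>a m\<close> with \<open>a \<in> A\<close> and \<open>m \<in> M\<close>.
\<close>

definition set_smult :: "('a, 'm) ring_scheme \<Rightarrow> ('a, 'b, 'n) module_scheme \<Rightarrow> 'a set \<Rightarrow> 'b set" where
  "set_smult R M A =
     \<Inter>{N. submodule N R M \<and> (\<forall>a\<in>A. \<forall>m\<in>carrier M. a \<odot>\<^bsub>M\<^esub> m \<in> N)}"

text \<open>
  A list \<open>f\<^sub>1, \<dots>, f\<^sub>r\<close> is an \<open>M\<close>-regular sequence if \<open>M \<noteq> (f\<^sub>1, \<dots>, f\<^sub>r) M\<close> and each \<open>f\<^sub>i\<close> is a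
  nonzerodivisor on \<open>M / (f\<^sub>1, \<dots>, f\<^sub>i\<^sub>-\<^sub>1) M\<close>. The latter is spelled out on representatives.
\<close>

definition regular_sequence :: "('a, 'm) ring_scheme \<Rightarrow> ('a, 'b, 'n) module_scheme \<Rightarrow> 'a list \<Rightarrow> bool" where
  "regular_sequence R M fs \<longleftrightarrow>
     set fs \<subseteq> carrier R \<and>
     (\<forall>i<length fs. \<forall>m\<in>carrier M.
        fs ! i \<odot>\<^bsub>M\<^esub> m \<in> set_smult R M (set (take i fs)) \<longrightarrow> m \<in> set_smult R M (set (take i fs))) \<and>
     set_smult R M (set fs) \<noteq> carrier M"

text \<open>
  The supremum is taken in \<^typ>\<open>enat\<close>, so that no finiteness has to be presupposed; whenever the
  lengths are bounded (and \<open>M \<noteq> 0\<close>) it is their maximum.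
\<close>

definition depth :: "('a, 'm) ring_scheme \<Rightarrow> 'a set \<Rightarrow> ('a, 'b, 'n) module_scheme \<Rightarrow> enat" where
  "depth R J M = Sup {enat (length fs) | fs. regular_sequence R M fs \<and> set fs \<subseteq> J}"

text \<open>\<open>R / I\<close> as an \<open>R\<close>-module: the quotient ring with \<open>r\<close> acting as multiplication by \<open>r + I\<close>.\<close>

definition quotient_module :: "('a, 'm) ring_scheme \<Rightarrow> 'a set \<Rightarrow> ('a, 'a set) module" where
  "quotient_module R I =
     ring.extend (R Quot I) (module.fields (\<lambda>r x. (I +>\<^bsub>R\<^esub> r) \<otimes>\<^bsub>R Quot I\<^esub> x))"

lemma quotient_module_is_module:
  assumes "cring R" and "ideal I R"
  shows "module R (quotient_module R I)"
proof -
  interpret R: cring R by fact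
  interpret I: ideal I R by fact
  interpret Q: cring "R Quot I" by (rule I.quotient_is_cring) fact
  have hom: "(+>\<^bsub>R\<^esub>) I \<in> ring_hom R (R Quot I)"
    by (rule I.rcos_ring_hom)
  have Q: "abelian_group (R Quot I)"
    by (rule Q.is_abelian_group)
  have "abelian_group (quotient_module R I)"
  proof (rule abelian_groupI)
    fix x assume "x \<in> carrier (quotient_module R I)"
    then show "\<exists>y\<in>carrier (quotient_module R I).
        y \<oplus>\<^bsub>quotient_module R I\<^esub> x = \<zero>\<^bsub>quotient_module R I\<^esub>"
      using Q.l_neg Q.a_inv_closed by (auto simp: quotient_module_def ring.defs module.defs)
  qed (auto simp: quotient_module_def ring.defs module.defs Q.a_ac)
  then show ?thesis
    using hom
    by (intro moduleI R.is_cring)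
       (auto simp: quotient_module_def ring.defs module.defs ring_hom_closed[OF hom]
          ring_hom_add[OF hom] ring_hom_mult[OF hom] ring_hom_one[OF hom]
          Q.l_distr Q.r_distr Q.m_assoc)
qed


section \<open>The polynomial ring\<close>

text \<open>
  The polynomial ring over \<open>'k\<close> whose variables are the elements of the finite type \<open>'v\<close>:
  finitely supported functions from exponent vectors to coefficients, with convolution product.
\<close>

type_synonym ('v, 'k) mpoly = "('v \<Rightarrow>\<^sub>0 nat) \<Rightarrow>\<^sub>0 'k"

abbreviation mpoly_ring :: "('v::finite, 'k::field) mpoly ring" where
  "mpoly_ring \<equiv> ring_of_type_algebra"

definition Var :: "'v::finite \<Rightarrow> ('v, 'k::field) mpoly" where
  "Var x = Poly_Mapping.single (Poly_Mapping.single x 1) 1"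

definition variables_ideal :: "('v::finite, 'k::field) mpoly set" where
  "variables_ideal = Idl\<^bsub>mpoly_ring\<^esub> (range Var)"


section \<open>Graphs with loops\<close>

text \<open>
  A graph is given by its edge set \<open>E\<close>; its vertices are all elements of the finite type \<open>'v\<close>.
  A loop at \<open>x\<close> is the edge \<open>{x, x} = {x}\<close>.
\<close>

definition graph :: "'v set set \<Rightarrow> bool" where
  "graph E \<longleftrightarrow> (\<forall>e\<in>E. \<exists>x y. e = {x, y})"

definition path_between :: "'v set set \<Rightarrow> 'v \<Rightarrow> 'v \<Rightarrow> 'v list \<Rightarrow> bool" where
  "path_between E u v p \<longleftrightarrow>
     p \<noteq> [] \<and> hd p = u \<and> last p = v \<and> distinct p \<and>
     (\<forall>i. Suc i < length p \<longrightarrow> {p ! i, p ! Suc i} \<in> E)"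

definition connected_graph :: "'v set set \<Rightarrow> bool" where
  "connected_graph E \<longleftrightarrow> (\<forall>u v. \<exists>p. path_between E u v p)"

text \<open>The length of a path is its number of edges. The value is meaningful only if a path exists.\<close>

definition distance :: "'v set set \<Rightarrow> 'v \<Rightarrow> 'v \<Rightarrow> nat" where
  "distance E u v = (LEAST n. \<exists>p. path_between E u v p \<and> length p = Suc n)"

definition edge_ideal :: "'v::finite set set \<Rightarrow> ('v, 'k::field) mpoly set" where
  "edge_ideal E = Idl\<^bsub>mpoly_ring\<^esub> {Var x * Var y | x y. {x, y} \<in> E}"

end

theory Submission
  imports Defs
begin

text \<open>
  On a shortest walk from \<open>u\<close> to a loop let \<open>v\<^sub>i\<close> be the vertex at distance \<open>3 i\<close> from \<open>u\<close>, for
  \<open>i < \<lceil>(l - 1) / 3\<rceil>\<close>. The closed neighbourhoods \<open>N[v\<^sub>i]\<close> are pairwise disjoint and contain no loop.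
  The sums \<open>f\<^sub>i\<close> of the variables in \<open>N[v\<^sub>i]\<close> form a regular sequence on \<open>R / I\<close>: a sequence that is
  weakly regular modulo \<open>J : b\<close> and modulo \<open>(J, b)\<close> is weakly regular modulo \<open>J\<close>. If \<open>J\<close> is
  generated by \<open>I\<close> and a set \<open>Z\<close> of variables and \<open>b\<close> is a variable outside \<open>Z\<close> without a loop, then
  \<open>J : b\<close> is \<open>I\<close> plus the variables in \<open>Z \<union> N(b)\<close>, so one may keep splitting at neighbours of the
  \<open>v\<^sub>i\<close>. This ends when each \<open>N[v\<^sub>i]\<close> contains a variable \<open>b\<^sub>i \<notin> Z\<close> all of whose neighbours are in
  \<open>Z\<close>. Then \<open>J\<close> is extended from the polynomial ring in the variables other than the \<open>b\<^sub>i\<close>, and \<open>f\<^sub>i\<close>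
  is \<open>b\<^sub>i\<close> plus a sum of such variables.
\<close>

section \<open>Ideals as spans\<close>

interpretation self: Modules.module "(*) :: 'a::comm_ring_1 \<Rightarrow> 'a \<Rightarrow> 'a"
  by unfold_locales (simp_all add: algebra_simps)

declare self.scale_scale [simp del] \<comment> \<open>loops with associativity\<close>

definition nonzerodivisor_mod :: "'a::comm_ring_1 set \<Rightarrow> 'a \<Rightarrow> bool" where
  "nonzerodivisor_mod S f \<longleftrightarrow> (\<forall>m. f * m \<in> self.span S \<longrightarrow> m \<in> self.span S)"

lemma nonzerodivisor_modI:
  "(\<And>m. f * m \<in> self.span S \<Longrightarrow> m \<in> self.span S) \<Longrightarrow> nonzerodivisor_mod S f"
  unfolding nonzerodivisor_mod_def by blast

lemma nonzerodivisor_modD: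
  "nonzerodivisor_mod S f \<Longrightarrow> f * m \<in> self.span S \<Longrightarrow> m \<in> self.span S"
  unfolding nonzerodivisor_mod_def by blast

text \<open>Properness of the quotient is left out, so that the splitting below tracks only
  nonzerodivisors; it is checked once, for the final sequence.\<close>

fun weakly_regular :: "'a::comm_ring_1 set \<Rightarrow> 'a list \<Rightarrow> bool" where
  "weakly_regular S [] \<longleftrightarrow> True"
| "weakly_regular S (f # fs) \<longleftrightarrow> nonzerodivisor_mod S f \<and> weakly_regular (insert f S) fs"

lemma weakly_regular_nth:
  assumes "weakly_regular S fs" "i < length fs"
  shows "nonzerodivisor_mod (S \<union> set (take i fs)) (fs ! i)"
  using assms
proof (induction fs arbitrary: S i)
  case (Cons f fs)
  show ?case
  proof (cases i)
    case 0
    then show ?thesis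
      using Cons.prems by simp
  next
    case (Suc j)
    then show ?thesis
      using Cons.IH[of "insert f S" j] Cons.prems by simp
  qed
qed simp

text \<open>If \<open>b * h\<close> equals \<open>c * f\<close> modulo \<open>(S)\<close>, then
  \<open>f * c\<close> lies in \<open>(S, b)\<close>. Cancelling \<open>f\<close> gives
  \<open>c = d * b\<close> modulo \<open>(S)\<close>, so \<open>h - d * f\<close> lies in the colon
  ideal. Hence the colon relation survives when a sequence is peeled off entry by entry.\<close>

lemma colon_span_insert:
  assumes colon: "\<And>h. b * h \<in> self.span S \<longleftrightarrow> h \<in> self.span S'"
    and nzd: "nonzerodivisor_mod (insert b S) f"
  shows "b * h \<in> self.span (insert f S) \<longleftrightarrow> h \<in> self.span (insert f S')"
proof
  assume "b * h \<in> self.span (insert f S)"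
  then obtain c where c: "b * h - c * f \<in> self.span S"
    unfolding self.span_breakdown_eq by blast
  then have "b * h - c * f \<in> self.span (insert b S)"
    using self.span_mono[of S "insert b S"] by blast
  moreover have "h * b \<in> self.span (insert b S)"
    by (rule self.span_scale, rule self.span_base) simp
  ultimately have "h * b - (b * h - c * f) \<in> self.span (insert b S)"
    by (metis self.span_diff)
  also have "h * b - (b * h - c * f) = f * c"
    by (simp add: mult.commute)
  finally have "c \<in> self.span (insert b S)"
    using nzd by (metis nonzerodivisor_modD)
  then obtain d where d: "c - d * b \<in> self.span S"
    unfolding self.span_breakdown_eq by blast
  have "(b * h - c * f) + f * (c - d * b) \<in> self.span S"
    using c self.span_scale[OF d] by (rule self.span_add)
  also have "(b * h - c * f) + f * (c - d * b) = b * (h - d * f)"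
    by (simp add: algebra_simps)
  finally have "h - d * f \<in> self.span S'"
    by (simp only: colon)
  then show "h \<in> self.span (insert f S')"
    unfolding self.span_breakdown_eq by blast
next
  assume "h \<in> self.span (insert f S')"
  then obtain c where "h - c * f \<in> self.span S'"
    unfolding self.span_breakdown_eq by blast
  then have "b * (h - c * f) \<in> self.span S"
    by (simp only: colon)
  also have "b * (h - c * f) = b * h - (b * c) * f"
    by (simp add: algebra_simps)
  finally show "b * h \<in> self.span (insert f S)"
    unfolding self.span_breakdown_eq by blast
qed

text \<open>
  For \<open>J = (S)\<close> and \<open>(S') = J : b\<close> this passes along
  \<open>0 \<rightarrow> R / (J : b) \<rightarrow> R / J \<rightarrow> R / (J, b) \<rightarrow> 0\<close> from the outer terms to the middle one.
\<close>

lemma weakly_regular_colon: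
  assumes "\<And>h. b * h \<in> self.span S \<longleftrightarrow> h \<in> self.span S'"
    and "weakly_regular S' fs" and "weakly_regular (insert b S) fs"
  shows "weakly_regular S fs"
  using assms
proof (induction fs arbitrary: S S')
  case (Cons f fs)
  note colon = Cons.prems(1)
  have nzd': "nonzerodivisor_mod S' f" and reg': "weakly_regular (insert f S') fs"
    using Cons.prems(2) by simp_all
  have nzd: "nonzerodivisor_mod (insert b S) f" and reg: "weakly_regular (insert b (insert f S)) fs"
    using Cons.prems(3) by (simp_all add: insert_commute)
  have "nonzerodivisor_mod S f"
  proof (rule nonzerodivisor_modI)
    fix m
    assume fm: "f * m \<in> self.span S"
    then have "f * m \<in> self.span (insert b S)"
      using self.span_mono[of S "insert b S"] by blast
    then have "m \<in> self.span (insert b S)"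
      by (rule nonzerodivisor_modD[OF nzd])
    then obtain k where k: "m - k * b \<in> self.span S"
      unfolding self.span_breakdown_eq by blast
    \<comment> \<open>Since \<open>m\<close> is \<open>k * b\<close> modulo \<open>(S)\<close>, the
      question moves to \<open>k\<close>: \<open>b * (f * k)\<close> lies in \<open>(S)\<close>, so
      \<open>f\<close> can be cancelled in the colon ideal.\<close>
    have "f * m - f * (m - k * b) \<in> self.span S"
      using fm self.span_scale[OF k] by (rule self.span_diff)
    also have "f * m - f * (m - k * b) = b * (f * k)"
      by (simp add: algebra_simps)
    finally have "f * k \<in> self.span S'"
      by (simp only: colon)
    then have "k \<in> self.span S'"
      by (rule nonzerodivisor_modD[OF nzd'])
    then have "b * k \<in> self.span S"
      by (simp only: colon)
    then have "b * k + (m - k * b) \<in> self.span S"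
      using k by (rule self.span_add)
    then show "m \<in> self.span S"
      by (simp add: mult.commute)
  qed
  moreover have "weakly_regular (insert f S) fs"
    using colon_span_insert[OF colon nzd] reg' reg by (rule Cons.IH)
  ultimately show ?case
    by simp
qed simp


section \<open>Coefficients with respect to one variable\<close>

lemma mpoly_induct [case_names monomial add]:
  fixes P :: "('v, 'k::field) mpoly \<Rightarrow> bool" and h :: "('v, 'k) mpoly"
  assumes "\<And>n c. P (Poly_Mapping.single n c)" and "\<And>f g. P f \<Longrightarrow> P g \<Longrightarrow> P (f + g)"
  shows "P h"
proof -
  have "P (\<Sum>n\<in>A. Poly_Mapping.single n (poly_mapping.lookup h n))" if "finite A" for A
    using that
  proof induction
    case empty
    then show ?case
      using assms(1)[of 0 0] by simp
  qed (simp add: assms)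
  moreover have "h = (\<Sum>n\<in>Poly_Mapping.keys h. Poly_Mapping.single n (poly_mapping.lookup h n))"
    by (rule poly_mapping_eqI)
      (simp add: lookup_sum lookup_single when_def sum.delta in_keys_iff)
  ultimately show ?thesis
    by (metis finite_keys)
qed

text \<open>
  The coefficient of \<open>b\<^sup>j\<close> in \<open>h\<close>, viewed as a polynomial in \<open>b\<close> over the ring in the other variables.
\<close>

definition var_coeff :: "'v \<Rightarrow> nat \<Rightarrow> ('v, 'k::field) mpoly \<Rightarrow> ('v, 'k) mpoly" where
  "var_coeff b j h = Abs_poly_mapping (\<lambda>n. if poly_mapping.lookup n b = 0
     then poly_mapping.lookup h (n + Poly_Mapping.single b j) else 0)"

lemma lookup_var_coeff:
  "poly_mapping.lookup (var_coeff b j h) n = (if poly_mapping.lookup n b = 0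
     then poly_mapping.lookup h (n + Poly_Mapping.single b j) else 0)"
proof -
  \<comment> \<open>Injectivity of the shift gives the finite support that
    \<open>Abs_poly_mapping\<close> requires.\<close>
  have "inj (\<lambda>n. n + Poly_Mapping.single b j)"
    by (simp add: inj_on_def)
  then have "finite ((\<lambda>n. n + Poly_Mapping.single b j) -` Poly_Mapping.keys h)"
    by (intro finite_vimageI) auto
  then have "finite {n. (if poly_mapping.lookup n b = 0
      then poly_mapping.lookup h (n + Poly_Mapping.single b j) else 0) \<noteq> 0}"
    by (rule rev_finite_subset) (auto simp: in_keys_iff)
  then show ?thesis
    unfolding var_coeff_def by simp
qed

lemma var_coeff_add: "var_coeff b j (f + g) = var_coeff b j f + var_coeff b j g"
  by (rule poly_mapping_eqI) (simp add: lookup_var_coeff lookup_add)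

lemma var_coeff_0 [simp]: "var_coeff b j 0 = 0"
  by (rule poly_mapping_eqI) (simp add: lookup_var_coeff)

lemma var_coeff_diff: "var_coeff b j (f - g) = var_coeff b j f - var_coeff b j g"
  by (metis var_coeff_add add_diff_cancel diff_add_cancel)

lemma var_coeff_single:
  "var_coeff b j (Poly_Mapping.single n c) = (if poly_mapping.lookup n b = j
     then Poly_Mapping.single (n - Poly_Mapping.single b j) c else 0)"
proof (rule poly_mapping_eqI)
  fix k
  let ?s = "Poly_Mapping.single b j"
  show "poly_mapping.lookup (var_coeff b j (Poly_Mapping.single n c)) k =
      poly_mapping.lookup (if poly_mapping.lookup n b = j then Poly_Mapping.single (n - ?s) c else 0) k"
  proof (cases "poly_mapping.lookup n b = j")
    case True
    then have "n - ?s + ?s = n"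
      by (intro poly_mapping_eqI) (auto simp: lookup_add lookup_minus lookup_single when_def)
    then have "n = k + ?s \<longleftrightarrow> n - ?s = k"
      by (metis add_diff_cancel_right')
    moreover have "n - ?s \<noteq> k" if "poly_mapping.lookup k b \<noteq> 0"
      using that True by (metis lookup_minus lookup_single_eq diff_self_eq_0)
    ultimately show ?thesis
      using True by (simp add: lookup_var_coeff lookup_single when_def)
  next
    case False
    then have "n \<noteq> k + ?s" if "poly_mapping.lookup k b = 0"
      using that by (metis lookup_add lookup_single_eq add_0)
    then show ?thesis
      using False by (simp add: lookup_var_coeff lookup_single when_def)
  qed
qed

lemma var_coeff_single_mult:
  "var_coeff b j (Poly_Mapping.single m c * h) = (if poly_mapping.lookup m b \<le> j
     then Poly_Mapping.single (m - Poly_Mapping.single b (poly_mapping.lookup m b)) c *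
       var_coeff b (j - poly_mapping.lookup m b) h else 0)"
proof (induction h rule: mpoly_induct)
  case (monomial n d)
  have "m + n - Poly_Mapping.single b (poly_mapping.lookup m b + poly_mapping.lookup n b) =
      (m - Poly_Mapping.single b (poly_mapping.lookup m b)) +
      (n - Poly_Mapping.single b (poly_mapping.lookup n b))"
    by (rule poly_mapping_eqI) (auto simp: lookup_add lookup_minus lookup_single when_def)
  then show ?case
    by (auto simp: mult_single var_coeff_single lookup_add)
next
  case (add f g)
  then show ?case
    by (simp add: distrib_left var_coeff_add)
qed

lemma var_coeff_Var_mult_other: "x \<noteq> b \<Longrightarrow> var_coeff b j (Var x * h) = Var x * var_coeff b j h"
  by (simp add: Var_def var_coeff_single_mult lookup_single)

lemma var_coeff_Var_mult_self:
  "var_coeff b j (Var b * h) = (case j of 0 \<Rightarrow> 0 | Suc i \<Rightarrow> var_coeff b i h)"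
  by (auto simp: Var_def var_coeff_single_mult split: nat.split)

lemma var_coeff_Var_other: "x \<noteq> b \<Longrightarrow> var_coeff b j (Var x) = (if j = 0 then Var x else 0)"
  by (simp add: Var_def var_coeff_single lookup_single)

text \<open>A bound \<open>N0\<close> good for all larger \<open>N\<close> replaces the degree in
  \<open>b\<close>: the maximum of two bounds serves a sum, whether or not leading terms
  cancel.\<close>

lemma var_coeff_expansion:
  fixes h :: "('v::finite, 'k::field) mpoly"
  shows "\<exists>N0. \<forall>N\<ge>N0. var_coeff b N h = 0 \<and>
    h = (\<Sum>j<N. Poly_Mapping.single (Poly_Mapping.single b j) 1 * var_coeff b j h)"
proof (induction h rule: mpoly_induct)
  case (monomial n c)
  let ?b = "poly_mapping.lookup n b"
  have n: "Poly_Mapping.single b ?b + (n - Poly_Mapping.single b ?b) = n"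
    by (rule poly_mapping_eqI) (auto simp: lookup_add lookup_minus lookup_single when_def)
  have "(\<Sum>j<N. Poly_Mapping.single (Poly_Mapping.single b j) 1 *
      var_coeff b j (Poly_Mapping.single n c)) = Poly_Mapping.single n c" if "N > ?b" for N
  proof -
    have "(\<Sum>j<N. Poly_Mapping.single (Poly_Mapping.single b j) 1 *
        var_coeff b j (Poly_Mapping.single n c)) =
      (\<Sum>j<N. if ?b = j then Poly_Mapping.single n c else 0)"
      by (intro sum.cong) (auto simp: var_coeff_single mult_single n)
    then show ?thesis
      using that by simp
  qed
  then show ?case
    by (intro exI[of _ "Suc ?b"]) (auto simp: var_coeff_single)
next
  case (add f g)
  from add.IH(1) obtain N1 where N1: "\<forall>N\<ge>N1. var_coeff b N f = 0 \<and>
    f = (\<Sum>j<N. Poly_Mapping.single (Poly_Mapping.single b j) 1 * var_coeff b j f)" ..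
  from add.IH(2) obtain N2 where N2: "\<forall>N\<ge>N2. var_coeff b N g = 0 \<and>
    g = (\<Sum>j<N. Poly_Mapping.single (Poly_Mapping.single b j) 1 * var_coeff b j g)" ..
  show ?case
  proof (intro exI[of _ "max N1 N2"] allI impI conjI)
    fix N
    assume N: "max N1 N2 \<le> N"
    then show "var_coeff b N (f + g) = 0"
      using N1 N2 by (simp add: var_coeff_add)
    have "(\<Sum>j<N. Poly_Mapping.single (Poly_Mapping.single b j) 1 * var_coeff b j (f + g)) =
        (\<Sum>j<N. Poly_Mapping.single (Poly_Mapping.single b j) 1 * var_coeff b j f) +
        (\<Sum>j<N. Poly_Mapping.single (Poly_Mapping.single b j) 1 * var_coeff b j g)"
      by (simp add: var_coeff_add distrib_left sum.distrib)
    also have "\<dots> = f + g"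
    proof (rule arg_cong2[where f = "(+)"])
      show "(\<Sum>j<N. Poly_Mapping.single (Poly_Mapping.single b j) 1 * var_coeff b j f) = f"
        by (rule N1[rule_format, THEN conjunct2, symmetric]) (use N in simp)
      show "(\<Sum>j<N. Poly_Mapping.single (Poly_Mapping.single b j) 1 * var_coeff b j g) = g"
        by (rule N2[rule_format, THEN conjunct2, symmetric]) (use N in simp)
    qed
    finally show "f + g =
        (\<Sum>j<N. Poly_Mapping.single (Poly_Mapping.single b j) 1 * var_coeff b j (f + g))" ..
  qed
qed

text \<open>Expresses that \<open>b\<close> does not occur in \<open>g\<close>: taking
  \<open>h = 1\<close> and \<open>j = 0\<close> gives \<open>var_coeff b 0 g = g\<close>. Linearity
  over \<open>g\<close> is the form in which this is applied.\<close>

definition free_of :: "'v \<Rightarrow> ('v, 'k::field) mpoly \<Rightarrow> bool" where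
  "free_of b g \<longleftrightarrow> (\<forall>j h. var_coeff b j (g * h) = g * var_coeff b j h)"

lemma free_of_sum_Var:
  assumes "b \<notin> A"
  shows "free_of b (\<Sum>x\<in>A. Var x)"
  using assms
proof (induction A rule: infinite_finite_induct)
  case (insert x A)
  then show ?case
    by (auto simp: free_of_def distrib_right var_coeff_add var_coeff_Var_mult_other)
qed (simp_all add: free_of_def)

text \<open>Says that the ideal \<open>(S)\<close> is extended from the polynomial ring in the variables other than \<open>b\<close>.\<close>

definition extended :: "'v \<Rightarrow> ('v, 'k::field) mpoly set \<Rightarrow> bool" where
  "extended b S \<longleftrightarrow> (\<forall>h\<in>self.span S. \<forall>j. var_coeff b j h \<in> self.span S)"

text \<open>Generators suffice: a coefficient of a monomial times \<open>s\<close> is zero or a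
  monomial times another coefficient of \<open>s\<close>, and multipliers are sums of
  monomials.\<close>

lemma extendedI:
  assumes gen: "\<And>s j. s \<in> S \<Longrightarrow> var_coeff b j s \<in> self.span S"
  shows "extended b S"
  unfolding extended_def
proof
  have scale: "var_coeff b j (a * s) \<in> self.span S" if "s \<in> S" for a s j
  proof (induction a rule: mpoly_induct)
    case (monomial n c)
    show ?case
      using gen[OF that] by (auto simp: var_coeff_single_mult self.span_zero intro: self.span_scale)
  next
    case (add f g)
    then show ?case
      by (simp add: distrib_right var_coeff_add self.span_add)
  qed
  show "\<forall>j. var_coeff b j h \<in> self.span S" if "h \<in> self.span S" for h
    using that
  proof (induction rule: self.span_induct_alt)
    case (step c x y)
    then show ?case
      using scale by (simp add: var_coeff_add self.span_add)
  qed (simp add: self.span_zero)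
qed

lemma extended_insert:
  assumes "extended b S" "free_of b f"
  shows "extended b (insert f S)"
  unfolding extended_def
proof (intro ballI allI)
  fix h j
  assume "h \<in> self.span (insert f S)"
  then obtain k where "h - k * f \<in> self.span S"
    by (auto simp: self.span_breakdown_eq)
  then have "var_coeff b j (h - f * k) \<in> self.span S"
    using assms(1) by (simp add: extended_def mult.commute)
  also have "var_coeff b j (h - f * k) = var_coeff b j h - var_coeff b j k * f"
    using assms(2) by (simp add: var_coeff_diff free_of_def mult.commute[of _ f])
  finally have "var_coeff b j h - var_coeff b j k * f \<in> self.span S" .
  then show "var_coeff b j h \<in> self.span (insert f S)"
    by (auto simp: self.span_breakdown_eq)
qed

text \<open>Over the ring in the other variables \<open>Var b + g\<close> is monic of degree one in
  \<open>b\<close>. This allows a descent from high powers of \<open>b\<close>: the next coefficient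
  of the product is \<open>var_coeff b j h + g * var_coeff b (Suc j) h\<close>.\<close>

lemma extended_nonzerodivisor:
  fixes g :: "('v::finite, 'k::field) mpoly"
  assumes ext: "extended b S" and g: "free_of b g"
  shows "nonzerodivisor_mod S (Var b + g)"
proof (rule nonzerodivisor_modI)
  fix h
  assume h: "(Var b + g) * h \<in> self.span S"
  obtain N0 where N0: "\<And>N. N \<ge> N0 \<Longrightarrow> var_coeff b N h = 0 \<and>
      h = (\<Sum>j<N. Poly_Mapping.single (Poly_Mapping.single b j) 1 * var_coeff b j h)"
    using var_coeff_expansion by blast
  have step: "var_coeff b j h \<in> self.span S" if "var_coeff b (Suc j) h \<in> self.span S" for j
  proof -
    have "var_coeff b (Suc j) ((Var b + g) * h) \<in> self.span S"
      using ext h by (simp add: extended_def)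
    then have "var_coeff b j h + g * var_coeff b (Suc j) h \<in> self.span S"
      using g by (simp add: distrib_right var_coeff_add var_coeff_Var_mult_self free_of_def)
    then show ?thesis
      using that self.span_scale self.span_add_eq2 by blast
  qed
  have "var_coeff b j h \<in> self.span S" for j
  proof (cases "j \<le> N0")
    case True
    then show ?thesis
    proof (induction rule: inc_induct)
      case base
      then show ?case
        using N0 by (simp add: self.span_zero)
    qed (rule step)
  qed (use N0 in \<open>simp add: self.span_zero\<close>)
  then have "(\<Sum>j<N0. Poly_Mapping.single (Poly_Mapping.single b j) 1 * var_coeff b j h) \<in> self.span S"
    by (intro self.span_sum self.span_scale)
  then show "h \<in> self.span S"
    using N0[of N0] by simp
qed

text \<open>Each \<open>f v\<close> is free of the variables \<open>\<beta> w\<close> of the other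
  entries, so adjoining it leaves the ideal extended with respect to those still to come.\<close>

lemma weakly_regular_extended:
  fixes f :: "'i \<Rightarrow> ('v::finite, 'k::field) mpoly"
  assumes "distinct vs"
    and "\<And>v. v \<in> set vs \<Longrightarrow> extended (\<beta> v) S"
    and "\<And>v. v \<in> set vs \<Longrightarrow> free_of (\<beta> v) (f v - Var (\<beta> v))"
    and "\<And>v w. v \<in> set vs \<Longrightarrow> w \<in> set vs \<Longrightarrow> v \<noteq> w \<Longrightarrow> free_of (\<beta> w) (f v)"
  shows "weakly_regular S (map f vs)"
  using assms
proof (induction vs arbitrary: S)
  case (Cons v vs)
  have "nonzerodivisor_mod S (Var (\<beta> v) + (f v - Var (\<beta> v)))"
    using Cons.prems by (intro extended_nonzerodivisor) auto
  moreover have "weakly_regular (insert (f v) S) (map f vs)"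
    using Cons.prems by (intro Cons.IH extended_insert) auto
  ultimately show ?case
    by simp
qed simp


section \<open>Stars in a graph\<close>

definition neighbours :: "'v set set \<Rightarrow> 'v \<Rightarrow> 'v set" where
  "neighbours E v = {w. {v, w} \<in> E}"

lemma neighbours_sym: "w \<in> neighbours E v \<longleftrightarrow> v \<in> neighbours E w"
  by (simp add: neighbours_def insert_commute)

definition star :: "'v::finite set set \<Rightarrow> 'v \<Rightarrow> ('v, 'k::field) mpoly" where
  "star E v = (\<Sum>x\<in>insert v (neighbours E v). Var x)"

definition edge_gens :: "'v::finite set set \<Rightarrow> ('v, 'k::field) mpoly set" where
  "edge_gens E = {Var x * Var y | x y. {x, y} \<in> E}"

text \<open>A generator containing \<open>b\<close> comes from an edge into \<open>Z\<close>, so it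
  is a multiple of a variable in \<open>Z\<close>, which differs from \<open>b\<close>. All other
  generators are free of \<open>b\<close>.\<close>

lemma extended_edge_gens:
  fixes E :: "'v::finite set set"
  assumes "b \<notin> Z" "neighbours E b \<subseteq> Z"
  shows "extended b (edge_gens E \<union> Var ` Z :: ('v, 'k::field) mpoly set)" (is "extended b ?S")
proof (rule extendedI)
  fix s :: "('v, 'k) mpoly" and j
  assume "s \<in> ?S"
  then consider x y where "{x, y} \<in> E" "s = Var x * Var y" | z where "z \<in> Z" "s = Var z"
    by (auto simp: edge_gens_def)
  then show "var_coeff b j s \<in> self.span ?S"
  proof cases
    case 1
    show ?thesis
    proof (cases "x \<in> Z \<or> y \<in> Z")
      case True
      then obtain z w where "z \<in> Z" and s: "s = Var z * Var w"
        using 1 mult.commute by blast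
      then have "z \<noteq> b"
        using assms by auto
      then have "var_coeff b j s = var_coeff b j (Var w) * Var z"
        by (simp add: s var_coeff_Var_mult_other mult.commute[of _ "Var z"])
      moreover have "Var z \<in> self.span ?S"
        using \<open>z \<in> Z\<close> by (intro self.span_base) blast
      ultimately show ?thesis
        by (simp add: self.span_scale)
    next
      case False
      then have "x \<noteq> b" "y \<noteq> b"
        using 1 assms by (auto simp: neighbours_def insert_commute)
      then have "var_coeff b j s = (if j = 0 then s else 0)"
        by (simp add: 1 var_coeff_Var_mult_other var_coeff_Var_other)
      then show ?thesis
        using \<open>s \<in> ?S\<close> by (auto simp: self.span_zero intro: self.span_base)
    qed
  next
    case 2
    then have "z \<noteq> b"
      using assms by auto
    then show ?thesis
      using 2 by (auto simp: var_coeff_Var_other self.span_zero intro: self.span_base)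
  qed
qed

text \<open>Multiplication by \<open>Var b\<close> turns the variables in
  \<open>neighbours E b\<close> into edge generators. Conversely, as \<open>b\<close> has no loop,
  the larger ideal is extended from the variables other than \<open>b\<close>, and
  \<open>Var b\<close> can be cancelled modulo it.\<close>

lemma colon_edge_gens:
  fixes h :: "('v::finite, 'k::field) mpoly"
  assumes "b \<notin> Z" "b \<notin> neighbours E b"
  shows "Var b * h \<in> self.span (edge_gens E \<union> Var ` Z) \<longleftrightarrow>
    h \<in> self.span (edge_gens E \<union> Var ` (Z \<union> neighbours E b))" (is "_ \<in> self.span ?S \<longleftrightarrow> _ \<in> self.span ?S'")
proof
  assume "Var b * h \<in> self.span ?S"
  then have "(Var b + 0) * h \<in> self.span ?S'"
    using self.span_mono[of ?S ?S'] by auto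
  moreover have "extended b ?S'"
    using assms by (intro extended_edge_gens) auto
  ultimately show "h \<in> self.span ?S'"
    using extended_nonzerodivisor[of b ?S' 0] by (metis nonzerodivisor_modD free_of_def mult_zero_left var_coeff_0)
next
  assume "h \<in> self.span ?S'"
  then show "Var b * h \<in> self.span ?S"
  proof (induction rule: self.span_induct_alt)
    case (step c x y)
    have "Var b * x \<in> self.span ?S"
    proof (cases "x \<in> ?S")
      case False
      then obtain w where "x = Var w" "{b, w} \<in> E"
        using step by (auto simp: neighbours_def)
      then have "Var b * x \<in> ?S"
        by (auto simp: edge_gens_def)
      then show ?thesis
        by (rule self.span_base)
    qed (auto intro: self.span_scale self.span_base)
    then have "c * (Var b * x) + Var b * y \<in> self.span ?S"
      by (rule self.span_add[OF self.span_scale step(2)])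
    then show ?case
      by (simp add: algebra_simps)
  qed (simp add: self.span_zero)
qed

text \<open>The last hypothesis is the invariant of the splitting: a centre \<open>v\<close> that
  has entered \<open>Z\<close> has a witness, a neighbour outside \<open>Z\<close> with all its
  neighbours in \<open>Z\<close>. Both branches of a split enlarge \<open>Z\<close>, so the
  induction is on the number of variables outside \<open>Z\<close>.\<close>

lemma weakly_regular_stars:
  fixes E :: "'v::finite set set"
  assumes distinct: "distinct vs"
    and loopless: "\<And>v x. v \<in> set vs \<Longrightarrow> x \<in> insert v (neighbours E v) \<Longrightarrow> x \<notin> neighbours E x"
    and disjoint: "\<And>v w x. v \<in> set vs \<Longrightarrow> w \<in> set vs \<Longrightarrow> x \<in> insert v (neighbours E v) \<Longrightarrow>
      x \<in> insert w (neighbours E w) \<Longrightarrow> v = w"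
    and "\<And>v. v \<in> set vs \<Longrightarrow> v \<notin> Z \<or> (\<exists>b\<in>neighbours E v - Z. neighbours E b \<subseteq> Z)"
  shows "weakly_regular (edge_gens E \<union> Var ` Z :: ('v, 'k::field) mpoly set) (map (star E) vs)"
  using assms(4)
proof (induction "card (- Z)" arbitrary: Z rule: less_induct)
  case less
  note inv = less.prems
  show ?case
  proof (cases "\<forall>v\<in>set vs. \<exists>b\<in>insert v (neighbours E v) - Z. neighbours E b \<subseteq> Z")
    case True
    then obtain \<beta> where \<beta>: "\<And>v. v \<in> set vs \<Longrightarrow>
        \<beta> v \<in> insert v (neighbours E v) - Z \<and> neighbours E (\<beta> v) \<subseteq> Z"
      by metis
    show ?thesis
    proof (rule weakly_regular_extended[where \<beta> = \<beta>])
      show "distinct vs" by (rule distinct)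
    next
      fix v
      assume v: "v \<in> set vs"
      then show "extended (\<beta> v) (edge_gens E \<union> Var ` Z :: ('v, 'k) mpoly set)"
        using \<beta> by (intro extended_edge_gens) auto
      have "star E v - Var (\<beta> v) = (\<Sum>x\<in>insert v (neighbours E v) - {\<beta> v}. Var x :: ('v, 'k) mpoly)"
        unfolding star_def using \<beta>[OF v]
        by (subst sum.remove[of _ "\<beta> v"]) auto
      then show "free_of (\<beta> v) (star E v - Var (\<beta> v) :: ('v, 'k) mpoly)"
        by (simp add: free_of_sum_Var)
    next
      fix v w
      assume "v \<in> set vs" "w \<in> set vs" "v \<noteq> w"
      then show "free_of (\<beta> w) (star E v :: ('v, 'k) mpoly)"
        unfolding star_def using \<beta> disjoint by (intro free_of_sum_Var) blast
    qed
  next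
    case False
    then obtain v where v: "v \<in> set vs"
      and nofree: "\<And>b. b \<in> insert v (neighbours E v) - Z \<Longrightarrow> \<not> neighbours E b \<subseteq> Z"
      by blast
    \<comment> \<open>A centre in \<open>Z\<close> would have a witness, against the choice of
      \<open>v\<close>. As \<open>v\<close> is itself outside \<open>Z\<close>, it must have a
      neighbour \<open>b\<close> outside \<open>Z\<close>; the ideal is split at this
      \<open>b\<close>.\<close>
    have "v \<notin> Z"
      using inv[OF v] nofree by blast
    then obtain b where b: "b \<in> neighbours E v" "b \<notin> Z"
      using nofree[of v] by blast
    then have vb: "v \<in> neighbours E b"
      using neighbours_sym by metis
    have "b \<notin> neighbours E b" "v \<noteq> b"
      using loopless[OF v, of b] loopless[OF v, of v] b by auto
    show ?thesis
    proof (rule weakly_regular_colon)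
      show "Var b * h \<in> self.span (edge_gens E \<union> Var ` Z) \<longleftrightarrow>
          h \<in> self.span (edge_gens E \<union> Var ` (Z \<union> neighbours E b))" for h :: "('v, 'k) mpoly"
        using b(2) \<open>b \<notin> neighbours E b\<close> by (rule colon_edge_gens)
      show "weakly_regular (edge_gens E \<union> Var ` (Z \<union> neighbours E b) :: ('v, 'k) mpoly set) (map (star E) vs)"
      proof (rule less.hyps)
        show "card (- (Z \<union> neighbours E b)) < card (- Z)"
          using \<open>v \<notin> Z\<close> vb by (intro psubset_card_mono) auto
        fix w
        assume w: "w \<in> set vs"
        show "w \<notin> Z \<union> neighbours E b \<or>
          (\<exists>b'\<in>neighbours E w - (Z \<union> neighbours E b). neighbours E b' \<subseteq> Z \<union> neighbours E b)"
        proof (cases "w \<in> Z")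
          case True
          then obtain b' where b': "b' \<in> neighbours E w - Z" "neighbours E b' \<subseteq> Z"
            using inv[OF w] by blast
          \<comment> \<open>Otherwise \<open>b\<close> would be a neighbour of \<open>b'\<close> and
            so lie in \<open>Z\<close>.\<close>
          then have "b' \<notin> neighbours E b"
            using b(2) neighbours_sym[of b' E b] by blast
          then show ?thesis
            using b' by blast
        next
          case False
          show ?thesis
          proof (cases "w \<in> neighbours E b")
            case True
            \<comment> \<open>A centre \<open>w\<close> that enters \<open>Z\<close> as a neighbour
              of \<open>b\<close> gets \<open>b\<close> as its witness.\<close>
            then have "b \<in> neighbours E w"
              using neighbours_sym by metis
            then show ?thesis
              using b \<open>b \<notin> neighbours E b\<close> by blast
          qed (use False in blast)
        qed
      qed
      have "weakly_regular (edge_gens E \<union> Var ` (insert b Z) :: ('v, 'k) mpoly set) (map (star E) vs)"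
      proof (rule less.hyps)
        show "card (- insert b Z) < card (- Z)"
          using b(2) by (intro psubset_card_mono) auto
        fix w
        assume w: "w \<in> set vs"
        show "w \<notin> insert b Z \<or> (\<exists>b'\<in>neighbours E w - insert b Z. neighbours E b' \<subseteq> insert b Z)"
        proof (cases "w \<in> Z")
          case True
          then obtain b' where b': "b' \<in> neighbours E w - Z" "neighbours E b' \<subseteq> Z"
            using inv[OF w] by blast
          \<comment> \<open>By the choice of \<open>v\<close>, not all neighbours of
            \<open>b\<close> are in \<open>Z\<close>, whereas those of \<open>b'\<close>
            are.\<close>
          then have "b' \<noteq> b"
            using nofree b by blast
          then show ?thesis
            using b' by blast
        next
          case False
          \<comment> \<open>This branch never adjoins a centre: \<open>w = b\<close> would lie in
            the closed neighbourhoods of \<open>v\<close> and \<open>w\<close>, forcing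
            \<open>w = v\<close>, but \<open>b\<close> differs from \<open>v\<close>.\<close>
          moreover have "w \<noteq> b"
            using disjoint[OF v w, of b] b(1) \<open>v \<noteq> b\<close> by blast
          ultimately show ?thesis
            by blast
        qed
      qed
      then show "weakly_regular (insert (Var b) (edge_gens E \<union> Var ` Z) :: ('v, 'k) mpoly set) (map (star E) vs)"
        by simp
    qed
  qed
qed

section \<open>Properness of ideals generated by polynomials with zero constant term\<close>

lemma one_notin_span:
  fixes S :: "('v::finite, 'k::field) mpoly set"
  assumes "\<And>s. s \<in> S \<Longrightarrow> 0 \<notin> Poly_Mapping.keys s"
  shows "1 \<notin> self.span S"
proof -
  have "0 \<notin> Poly_Mapping.keys h" if "h \<in> self.span S" for h
    using that
  proof (induction rule: self.span_induct_alt)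
    case (step c x y)
    \<comment> \<open>Exponents are natural numbers, so the exponent vector \<open>0\<close> arises
      in a product only from \<open>0\<close> in both factors.\<close>
    have zero: "n = 0" if "0 = m + n" for m n :: "'v \<Rightarrow>\<^sub>0 nat"
    proof (rule poly_mapping_eqI)
      fix x
      have "poly_mapping.lookup m x + poly_mapping.lookup n x = 0"
        using that by (metis lookup_add lookup_zero)
      then show "poly_mapping.lookup n x = poly_mapping.lookup 0 x"
        by simp
    qed
    have "0 \<notin> Poly_Mapping.keys (c * x)"
    proof
      assume "0 \<in> Poly_Mapping.keys (c * x)"
      then have "0 \<in> {m + n | m n. m \<in> Poly_Mapping.keys c \<and> n \<in> Poly_Mapping.keys x}"
        using keys_mult[of c x] by (rule subsetD[rotated])
      then obtain m n where "0 = m + n" "n \<in> Poly_Mapping.keys x"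
        by blast
      then show False
        using zero assms[OF step(1)] by blast
    qed
    then show ?case
      using step keys_add[of "c * x" y] by blast
  qed simp
  then show ?thesis
    by fastforce
qed

lemma zero_notin_keys_Var: "0 \<notin> Poly_Mapping.keys (Var x)"
proof -
  have "Poly_Mapping.single x (1 :: nat) \<noteq> 0"
    by (metis lookup_single_eq lookup_zero zero_neq_one)
  then show ?thesis
    by (auto simp: Var_def)
qed

lemma span_range_Var_proper: "1 \<notin> self.span (range Var)"
  by (rule one_notin_span) (auto simp: zero_notin_keys_Var)


section \<open>Regular sequences on a quotient ring\<close>

lemma ring_of_type_algebra_simps [simp]:
  "carrier (ring_of_type_algebra :: 'a::comm_ring_1 ring) = UNIV"
  "x \<otimes>\<^bsub>ring_of_type_algebra\<^esub> y = x * (y :: 'a)"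
  "\<one>\<^bsub>ring_of_type_algebra\<^esub> = (1 :: 'a)"
  "x \<oplus>\<^bsub>ring_of_type_algebra\<^esub> y = x + (y :: 'a)"
  "\<zero>\<^bsub>ring_of_type_algebra\<^esub> = (0 :: 'a)"
  by (simp_all add: ring_of_type_algebra_def)

lemma ideal_ring_of_type_algebra_iff:
  fixes J :: "'a::comm_ring_1 set"
  shows "ideal J ring_of_type_algebra \<longleftrightarrow> self.subspace J"
proof
  assume "ideal J ring_of_type_algebra"
  then interpret ideal J "ring_of_type_algebra :: 'a ring" .
  show "self.subspace J"
    using additive_subgroup.zero_closed[OF is_additive_subgroup]
      additive_subgroup.a_closed[OF is_additive_subgroup] I_l_closed
    by (auto simp: self.subspace_def)
next
  assume J: "self.subspace J"
  interpret R: cring "ring_of_type_algebra :: 'a ring"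
    by (rule cring_from_type_algebra)
  have neg: "\<ominus>\<^bsub>ring_of_type_algebra\<^esub> x = - x" for x :: 'a
    by (rule R.minus_equality) auto
  have scale: "x * a \<in> J" "a * x \<in> J" if "a \<in> J" for a x
    using self.subspace_scale[OF J that, of x] by (simp_all add: mult.commute)
  show "ideal J ring_of_type_algebra"
  proof (rule idealI)
    show "subgroup J (add_monoid ring_of_type_algebra)"
      using J neg
      by (intro R.add.subgroupI)
        (auto simp: self.subspace_neg self.subspace_add simp flip: a_inv_def dest: self.subspace_0)
  qed (use scale in \<open>auto simp: R.ring_axioms\<close>)
qed

lemma genideal_ring_of_type_algebra:
  "Idl\<^bsub>ring_of_type_algebra\<^esub> S = self.span (S :: 'a::comm_ring_1 set)"
  by (simp add: genideal_def self.span_def hull_def ideal_ring_of_type_algebra_iff)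

text \<open>The image of \<open>(I, A)\<close> in the quotient is a submodule containing all the
  products. Conversely, the preimage of any such submodule is an ideal containing \<open>I\<close>
  and, through the class of \<open>1\<close>, also \<open>A\<close>.\<close>

lemma set_smult_quotient_module:
  fixes I :: "'a::comm_ring_1 set" and R :: "'a ring"
  defines "R \<equiv> ring_of_type_algebra"
  assumes "ideal I R"
  shows "I +>\<^bsub>R\<^esub> x \<in> set_smult R (quotient_module R I) A \<longleftrightarrow> x \<in> self.span (I \<union> A)"
proof -
  interpret R: cring R
    unfolding R_def by (rule cring_from_type_algebra)
  interpret I: ideal I R by fact
  let ?M = "quotient_module R I"
  let ?c = "\<lambda>x. I +>\<^bsub>R\<^esub> x"
  interpret M: module R ?M
    by (rule quotient_module_is_module) (fact R.is_cring, fact)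
  have carrR: "a \<in> carrier R" for a
    by (simp add: R_def)
  have sub: "self.subspace I"
    using assms ideal_ring_of_type_algebra_iff by blast
  have carr: "carrier ?M = range ?c"
    by (auto simp: quotient_module_def ring.defs module.defs FactRing_def A_RCOSETS_def'
        R_def)
  have add: "?c x \<oplus>\<^bsub>?M\<^esub> ?c y = ?c (x + y)" for x y
    using ring_hom_add[OF I.rcos_ring_hom, of x y]
    by (simp add: quotient_module_def ring.defs module.defs R_def)
  have smult: "a \<odot>\<^bsub>?M\<^esub> ?c y = ?c (a * y)" for a y
    using ring_hom_mult[OF I.rcos_ring_hom, of a y]
    by (simp add: quotient_module_def ring.defs module.defs R_def)
  have coset: "?c x = (\<lambda>i. i + x) ` I" for x
    by (auto simp: a_r_coset_def' R_def)
  have zero: "\<zero>\<^bsub>?M\<^esub> = ?c 0"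
    by (simp add: quotient_module_def ring.defs module.defs FactRing_def coset)
  have eq_iff: "?c x = ?c y \<longleftrightarrow> x - y \<in> I" for x y
  proof
    assume "?c x = ?c y"
    moreover have "x \<in> ?c x"
      using self.subspace_0[OF sub] by (force simp: coset)
    ultimately show "x - y \<in> I"
      by (auto simp: coset)
  next
    assume xy: "x - y \<in> I"
    have "i + x = (i + (x - y)) + y" "i + y = (i - (x - y)) + x" for i
      by simp_all
    then show "?c x = ?c y"
      unfolding coset using self.subspace_add[OF sub _ xy] self.subspace_diff[OF sub _ xy] by blast
  qed
  have neg: "\<ominus>\<^bsub>?M\<^esub> ?c x = ?c (- x)" for x
    by (rule M.minus_equality) (auto simp: add zero carr)
  show ?thesis
  proof
    let ?N = "?c ` self.span (I \<union> A)"
    assume "?c x \<in> set_smult R ?M A"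
    moreover have "submodule ?N R ?M"
    proof (rule M.submoduleI)
      show "\<zero>\<^bsub>?M\<^esub> \<in> ?N"
        by (auto simp: zero self.span_zero)
    qed (auto simp: carr neg add smult self.span_neg self.span_add self.span_scale intro!: imageI)
    moreover have "\<forall>a\<in>A. \<forall>m\<in>carrier ?M. a \<odot>\<^bsub>?M\<^esub> m \<in> ?N"
    proof (intro ballI)
      fix a m
      assume "a \<in> A" "m \<in> carrier ?M"
      then obtain y where "m = ?c y"
        by (auto simp: carr)
      moreover have "y * a \<in> self.span (I \<union> A)"
        using \<open>a \<in> A\<close> by (intro self.span_scale self.span_base) auto
      ultimately show "a \<odot>\<^bsub>?M\<^esub> m \<in> ?N"
        by (auto simp: smult mult.commute)
    qed
    ultimately have "?c x \<in> ?N"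
      unfolding set_smult_def by blast
    then obtain y where y: "y \<in> self.span (I \<union> A)" "x - y \<in> I"
      by (auto simp: eq_iff)
    then have "x - y \<in> self.span (I \<union> A)"
      by (intro self.span_base) blast
    then have "(x - y) + y \<in> self.span (I \<union> A)"
      using y(1) by (rule self.span_add)
    then show "x \<in> self.span (I \<union> A)"
      by simp
  next
    assume x: "x \<in> self.span (I \<union> A)"
    have "?c x \<in> N" if N: "submodule N R ?M" and A: "\<forall>a\<in>A. \<forall>m\<in>carrier ?M. a \<odot>\<^bsub>?M\<^esub> m \<in> N" for N
    proof -
      have N0: "?c 0 \<in> N"
        using subgroup.one_closed[OF submodule.axioms(1)[OF N]] by (simp add: zero)
      have "self.subspace {x. ?c x \<in> N}"
        unfolding self.subspace_def
      proof (intro conjI ballI allI)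
        show "0 \<in> {x. ?c x \<in> N}"
          using N0 by simp
        show "x + y \<in> {x. ?c x \<in> N}" if "x \<in> {x. ?c x \<in> N}" "y \<in> {x. ?c x \<in> N}" for x y
          using M.submoduleE(5)[OF N, of "?c x" "?c y"] that by (simp add: add)
        show "a * y \<in> {x. ?c x \<in> N}" if "y \<in> {x. ?c x \<in> N}" for a y
          using M.submoduleE(4)[OF N, of a "?c y"] that carrR by (simp add: smult)
      qed
      moreover have "I \<union> A \<subseteq> {x. ?c x \<in> N}"
      proof
        fix y
        assume "y \<in> I \<union> A"
        then show "y \<in> {x. ?c x \<in> N}"
        proof
          assume "y \<in> I"
          then have "?c y = ?c 0"
            by (simp add: eq_iff)
          then show ?thesis
            using N0 by simp
        next
          assume "y \<in> A"
          then have "y \<odot>\<^bsub>?M\<^esub> ?c 1 \<in> N"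
            using A by (auto simp: carr)
          then show ?thesis
            by (simp add: smult)
        qed
      qed
      ultimately show ?thesis
        using self.span_minimal[of "I \<union> A" "{x. ?c x \<in> N}"] x by auto
    qed
    then show "?c x \<in> set_smult R ?M A"
      unfolding set_smult_def by blast
  qed
qed

lemma regular_sequence_quotientI:
  fixes S :: "'a::comm_ring_1 set" and R :: "'a ring"
  defines "R \<equiv> ring_of_type_algebra"
  assumes reg: "weakly_regular S fs" and proper: "1 \<notin> self.span (S \<union> set fs)"
  shows "regular_sequence R (quotient_module R (self.span S)) fs"
proof -
  let ?I = "self.span S"
  let ?M = "quotient_module R ?I"
  have I: "ideal ?I R"
    by (simp add: R_def ideal_ring_of_type_algebra_iff)
  have "self.span (?I \<union> A) = self.span (S \<union> A)" for A
    by (simp only: self.span_Un self.span_span)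
  then have mem: "?I +>\<^bsub>R\<^esub> x \<in> set_smult R ?M A \<longleftrightarrow> x \<in> self.span (S \<union> A)" for x A
    using set_smult_quotient_module[of ?I x A] I by (simp add: R_def)
  have carr: "carrier ?M = range (\<lambda>x. ?I +>\<^bsub>R\<^esub> x)"
    by (auto simp: quotient_module_def ring.defs module.defs FactRing_def A_RCOSETS_def' R_def)
  have smult: "a \<odot>\<^bsub>?M\<^esub> (?I +>\<^bsub>R\<^esub> y) = ?I +>\<^bsub>R\<^esub> (a * y)" for a y
    using ring_hom_mult[OF ideal.rcos_ring_hom[OF I], of a y]
    by (simp add: quotient_module_def ring.defs module.defs R_def)
  have "?I +>\<^bsub>R\<^esub> 1 \<notin> set_smult R ?M (set fs)"
    using proper by (simp add: mem)
  then have "set_smult R ?M (set fs) \<noteq> carrier ?M"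
    by (auto simp: carr)
  moreover have "m \<in> set_smult R ?M (set (take i fs))"
    if i: "i < length fs" and "m \<in> carrier ?M" "fs ! i \<odot>\<^bsub>?M\<^esub> m \<in> set_smult R ?M (set (take i fs))" for i m
    using that(2,3) nonzerodivisor_modD[OF weakly_regular_nth[OF reg i]] by (auto simp: carr smult mem)
  moreover have "set fs \<subseteq> carrier R"
    by (simp add: R_def)
  ultimately show ?thesis
    by (simp add: regular_sequence_def)
qed


section \<open>Walks\<close>

text \<open>Powers of the adjacency relation encode walks, which may repeat vertices and can be
  concatenated freely, unlike paths. The exponent counts edges.\<close>

lemma relpow_path_between:
  assumes "path_between E u v p"
  shows "(u, v) \<in> {(x, y). {x, y} \<in> E} ^^ (length p - 1)"
proof -
  have "\<exists>f. f 0 = u \<and> f (length p - 1) = v \<and> (\<forall>i<length p - 1. (f i, f (Suc i)) \<in> {(x, y). {x, y} \<in> E})"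
    using assms by (intro exI[of _ "(!) p"]) (auto simp: path_between_def hd_conv_nth last_conv_nth)
  then show ?thesis
    by (simp add: relpow_fun_conv)
qed

text \<open>With \<open>k = 0\<close> this removes a repeated vertex from a walk; with
  \<open>k \<le> 2\<close> it limits how close two vertices on a shortest walk can be.\<close>

lemma relpow_shortcut:
  assumes "f 0 = u" "f n = v" "\<And>i. i < n \<Longrightarrow> (f i, f (Suc i)) \<in> r"
    and "(f i, f j) \<in> r ^^ k" "i \<le> n" "j \<le> n"
  shows "(u, v) \<in> r ^^ (i + k + (n - j))"
proof -
  have "(u, f i) \<in> r ^^ i"
    unfolding relpow_fun_conv using assms by (intro exI[of _ f]) auto
  moreover have "(f j, v) \<in> r ^^ (n - j)"
    unfolding relpow_fun_conv using assms by (intro exI[of _ "\<lambda>i. f (j + i)"]) auto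
  ultimately show ?thesis
    using assms(4) by (auto simp: relpow_add)
qed

text \<open>A walk of least length repeats no vertex, since cutting out the closed piece would
  shorten it; hence it is a path.\<close>

lemma distance_le_walk:
  assumes "(u, v) \<in> {(x, y). {x, y} \<in> E} ^^ n"
  shows "distance E u v \<le> n"
proof -
  let ?r = "{(x, y). {x, y} \<in> E}"
  define m where "m = (LEAST m. (u, v) \<in> ?r ^^ m)"
  have "(u, v) \<in> ?r ^^ m" and min: "\<And>k. (u, v) \<in> ?r ^^ k \<Longrightarrow> m \<le> k"
    using assms by (auto simp: m_def intro: LeastI Least_le)
  then obtain f where f: "f 0 = u" "f m = v" "\<And>i. i < m \<Longrightarrow> (f i, f (Suc i)) \<in> ?r"
    by (auto simp: relpow_fun_conv)
  have "f i \<noteq> f j" if "i < j" "j \<le> m" for i j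
  proof
    assume "f i = f j"
    then have "(u, v) \<in> ?r ^^ (i + 0 + (m - j))"
      using that by (intro relpow_shortcut[where f = f, OF f]) auto
    then show False
      using min that by fastforce
  qed
  then have "inj_on f {0..<Suc m}"
    by (metis atLeastLessThan_iff inj_onI less_Suc_eq_le linorder_neqE_nat)
  then have "path_between E u v (map f [0..<Suc m])"
    using f unfolding path_between_def
    by (auto simp: distinct_map hd_map last_map nth_append simp del: upt_Suc)
  then have "distance E u v \<le> m"
    unfolding distance_def by (intro Least_le exI[of _ "map f [0..<Suc m]"]) auto
  then show ?thesis
    using min[OF assms] by simp
qed

text \<open>Chosen vertices are at least \<open>3\<close> steps apart on a shortest walk, but a
  common point of their closed neighbourhoods would join them by at most \<open>2\<close> edges. A
  loop in such a neighbourhood would be within \<open>3 * r - 2\<close> edges of \<open>u\<close>,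
  one too few.\<close>

lemma exists_separated_vertices:
  fixes E :: "'v set set"
  assumes conn: "connected_graph E" and loop: "{x0, x0} \<in> E"
    and far: "\<And>x. {x, x} \<in> E \<Longrightarrow> 3 * r \<le> Suc (distance E u x)"
  obtains vs :: "'v list" where "length vs = r" "distinct vs"
    "\<And>v x. v \<in> set vs \<Longrightarrow> x \<in> insert v (neighbours E v) \<Longrightarrow> x \<notin> neighbours E x"
    "\<And>v w x. v \<in> set vs \<Longrightarrow> w \<in> set vs \<Longrightarrow> x \<in> insert v (neighbours E v) \<Longrightarrow>
      x \<in> insert w (neighbours E w) \<Longrightarrow> v = w"
proof -
  let ?r = "{(x, y). {x, y} \<in> E}"
  obtain p where p: "path_between E u x0 p"
    using conn by (auto simp: connected_graph_def)
  have ex: "\<exists>n. (u, x0) \<in> ?r ^^ n"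
    using relpow_path_between[OF p] by (rule exI)
  define n where "n = (LEAST n. (u, x0) \<in> ?r ^^ n)"
  have walk: "(u, x0) \<in> ?r ^^ n" and min: "\<And>k. (u, x0) \<in> ?r ^^ k \<Longrightarrow> n \<le> k"
    using ex by (auto simp: n_def intro: LeastI_ex Least_le)
  obtain f where f: "f 0 = u" "f n = x0" "\<And>i. i < n \<Longrightarrow> (f i, f (Suc i)) \<in> ?r"
    using walk by (auto simp: relpow_fun_conv)
  \<comment> \<open>The walk has at least \<open>3 * r - 1\<close> edges, so all positions
    \<open>3 * i\<close> with \<open>i < r\<close> lie on it.\<close>
  have n: "3 * r \<le> Suc n"
    using far[OF loop] distance_le_walk[OF walk] by simp
  have near: "\<exists>k\<le>1. (v, x) \<in> ?r ^^ k \<and> (x, v) \<in> ?r ^^ k" if "x \<in> insert v (neighbours E v)" for v x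
  proof (cases "x = v")
    case False
    then show ?thesis
      using that by (intro exI[of _ 1]) (auto simp: neighbours_def insert_commute)
  qed auto
  have sep: "\<not> i < j" if ij: "i < r" "j < r" and x: "x \<in> insert (f (3 * i)) (neighbours E (f (3 * i)))"
      "x \<in> insert (f (3 * j)) (neighbours E (f (3 * j)))" for i j x
  proof
    assume "i < j"
    obtain k1 k2 where k: "k1 \<le> 1" "(f (3 * i), x) \<in> ?r ^^ k1" "k2 \<le> 1" "(x, f (3 * j)) \<in> ?r ^^ k2"
      using near[OF x(1)] near[OF x(2)] by blast
    then have "(f (3 * i), f (3 * j)) \<in> ?r ^^ (k1 + k2)"
      by (auto simp: relpow_add)
    then have "(u, x0) \<in> ?r ^^ (3 * i + (k1 + k2) + (n - 3 * j))"
      using ij n by (intro relpow_shortcut[where f = f, OF f]) auto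
    then show False
      using min k ij n \<open>i < j\<close> by fastforce
  qed
  have eq: "i = j" if "i < r" "j < r" "x \<in> insert (f (3 * i)) (neighbours E (f (3 * i)))"
      "x \<in> insert (f (3 * j)) (neighbours E (f (3 * j)))" for i j x
    using sep[OF that] sep[OF that(2,1,4,3)] by simp
  show thesis
  proof (rule that[of "map (\<lambda>i. f (3 * i)) [0..<r]"])
    show "distinct (map (\<lambda>i. f (3 * i)) [0..<r])"
      unfolding distinct_map
    proof (intro conjI inj_onI)
      fix i j
      assume "i \<in> set [0..<r]" "j \<in> set [0..<r]" "f (3 * i) = f (3 * j)"
      then show "i = j"
        using eq[of i j "f (3 * i)"] by simp
    qed simp
    show "x \<notin> neighbours E x"
      if v: "v \<in> set (map (\<lambda>i. f (3 * i)) [0..<r])" and x: "x \<in> insert v (neighbours E v)" for v x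
    proof
      assume "x \<in> neighbours E x"
      then have xx: "{x, x} \<in> E"
        by (simp add: neighbours_def)
      obtain i where i: "i < r" "v = f (3 * i)"
        using v by auto
      obtain k where "k \<le> 1" and k: "(f (3 * i), x) \<in> ?r ^^ k"
        using near[OF x] i by blast
      have "(u, f (3 * i)) \<in> ?r ^^ (3 * i)"
        unfolding relpow_fun_conv using f i n by (intro exI[of _ f]) auto
      then have "(u, x) \<in> ?r ^^ (3 * i + k)"
        using k by (auto simp: relpow_add)
      then show False
        using distance_le_walk[of u x "3 * i + k" E] far[OF xx] i \<open>k \<le> 1\<close> by simp
    qed
    show "v = w" if "v \<in> set (map (\<lambda>i. f (3 * i)) [0..<r])" "w \<in> set (map (\<lambda>i. f (3 * i)) [0..<r])"
        "x \<in> insert v (neighbours E v)" "x \<in> insert w (neighbours E w)" for v w x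
      using eq that by fastforce
  qed simp
qed

theorem proposition3p5:
  fixes E :: "'v::finite set set"
    and I :: "('v, 'k::field) mpoly set"
    and l :: int
  assumes "graph E"
    and "connected_graph E"
    and "\<exists>x. {x, x} \<in> E"
    and "I = edge_ideal E"
    and "\<exists>u. \<forall>x. {x, x} \<in> E \<longrightarrow> int (distance E u x) \<ge> l"
  shows "depth mpoly_ring variables_ideal (quotient_module mpoly_ring I)
           \<ge> enat (nat \<lceil>(real_of_int l - 1) / 3\<rceil>)"
proof -
  define r where "r = nat \<lceil>(real_of_int l - 1) / 3\<rceil>"
  \<comment> \<open>Rounding up gives less than \<open>l + 2\<close>, hence at most
    \<open>l + 1\<close> over the integers; \<open>r = 0\<close> covers a negative ceiling, which
    \<open>nat\<close> truncates.\<close>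
  have r: "r = 0 \<or> 3 * int r \<le> l + 1"
  proof -
    have "real_of_int (3 * \<lceil>(real_of_int l - 1) / 3\<rceil>) < real_of_int (l + 2)"
      using ceiling_correct[of "(real_of_int l - 1) / 3"] by simp
    then have "3 * \<lceil>(real_of_int l - 1) / 3\<rceil> < l + 2"
      by (simp only: of_int_less_iff)
    then show ?thesis
      unfolding r_def by arith
  qed
  obtain u x0 where u: "\<And>x. {x, x} \<in> E \<Longrightarrow> l \<le> int (distance E u x)" and "{x0, x0} \<in> E"
    using assms by blast
  have "3 * r \<le> Suc (distance E u x)" if "{x, x} \<in> E" for x
    using u[OF that] r by linarith
  then obtain vs where vs: "length vs = r" "distinct vs"
    "\<And>v x. v \<in> set vs \<Longrightarrow> x \<in> insert v (neighbours E v) \<Longrightarrow> x \<notin> neighbours E x"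
    "\<And>v w x. v \<in> set vs \<Longrightarrow> w \<in> set vs \<Longrightarrow> x \<in> insert v (neighbours E v) \<Longrightarrow>
      x \<in> insert w (neighbours E w) \<Longrightarrow> v = w"
    using exists_separated_vertices[OF assms(2) \<open>{x0, x0} \<in> E\<close>] by metis
  define fs :: "('v, 'k) mpoly list" where "fs = map (star E) vs"
  \<comment> \<open>The splitting starts with no variable adjoined, where the invariant is
    trivial.\<close>
  have "weakly_regular (edge_gens E \<union> Var ` {}) fs"
    unfolding fs_def using vs(2-) by (rule weakly_regular_stars) simp_all
  then have reg: "weakly_regular (edge_gens E) fs"
    by simp
  have fs: "set fs \<subseteq> self.span (range Var)"
    unfolding fs_def star_def by (auto intro: self.span_sum self.span_base)
  \<comment> \<open>Edge generators and stars all lie in the proper ideal of the variables, which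
    supplies the properness omitted from \<open>weakly_regular\<close>.\<close>
  have "edge_gens E \<subseteq> self.span (range Var :: ('v, 'k) mpoly set)"
    by (auto simp: edge_gens_def intro: self.span_scale self.span_base)
  then have "self.span (edge_gens E \<union> set fs) \<subseteq> self.span (range Var)"
    using fs by (intro self.span_minimal) auto
  then have "1 \<notin> self.span (edge_gens E \<union> set fs)"
    using span_range_Var_proper by blast
  then have "regular_sequence mpoly_ring (quotient_module mpoly_ring I) fs"
    using regular_sequence_quotientI[OF reg]
    by (simp add: assms(4) edge_ideal_def edge_gens_def genideal_ring_of_type_algebra)
  moreover have "set fs \<subseteq> variables_ideal"
    using fs by (simp add: variables_ideal_def genideal_ring_of_type_algebra)
  moreover have "length fs = r"
    by (simp add: fs_def vs(1))
  ultimately show ?thesis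
    unfolding depth_def r_def[symmetric] by (intro Sup_upper) blast
qed

end
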